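(* Let $m,q\ge 2$ be integers, let $\lambda = (a_k,a_{k-1},\ldots, a_0)_m$ be a conjugate $(m,q)$-ary partition of the integer $n$ with $a_k \neq 0$, and let $\lambda' = (b_\ell,b_{\ell-1},\ldots, b_1, b_0)_q$ be the conjugate $(q,m)$-ary partition. Then (1) $R_{mq}(\lambda)' = S_{qm}(\lambda')$ and $S_{mq}(\lambda)' = R_{qm}(\lambda')$; (2) $M_{mq}(\lambda)' = J_{qm}(\lambda')$ and $J_{mq}(\lambda)' = M_{qm}(\lambda')$.
   Context: Let $m,q\ge 2$ be integers. A partition $\lambda$ of a positive integer $n$ is $m$-ary if all its parts are powers $m^i$, $i\ge 0$ (so $m^0=1$ is allowed). If $a_i$ is the number of times the part $m^i$ appears in $\lambda$, one writes $\lambda=(a_k,a_{k-1},\ldots,a_0)_m$, where $a_k\neq 0$ and $a_i=0$ for $i>k$. The conjugate $\lambda'$ is obtained by reflecting the Ferrers diagram across the main diagonal. $\lambda$ is conjugate $(m,q)$-ary if $\lambda$ is $m$-ary and $\lambda'$ is $q$-ary; equivalently, $\lambda$ is $m$-ary and each partial sum $\sum_{i=r}^k a_i$, $0\le r\le k$, is a power of $q$ (with $q^0=1$ allowed). For a conjugate $(m,q)$-ary partition $\lambda=(a_k,\ldots,a_0)_m$ with $\sum_{i=0}^k a_i=q^t$, define the operators (each producing a conjugate $(m,q)$-ary partition): raise $R_{mq}(\lambda)=(qa_k,qa_{k-1},\ldots,qa_0)_m$; migration $M_{mq}(\lambda)=(1,a_k-1,a_{k-1},\ldots,a_0)_m$;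 shift $S_{mq}(\lambda)=(a_k,a_{k-1},\ldots,a_0,0)_m$; jump $J_{mq}(\lambda)=(a_k,\ldots,a_1,a_0+q^{t+1}-q^t)_m$. The operators $R_{qm},M_{qm},S_{qm},J_{qm}$ are defined the same way with the roles of $m$ and $q$ exchanged, acting on conjugate $(q,m)$-ary partitions. *)

theory Defs
  imports "HOL-Library.Multiset"
begin

text \<open>A partition is the weakly decreasing list of its parts.\<close>

definition partition_of :: "nat \<Rightarrow> nat list \<Rightarrow> bool" where
  "partition_of n xs \<longleftrightarrow> sorted_wrt (\<ge>) xs \<and> 0 \<notin> set xs \<and> sum_list xs = n"

definition ferrers :: "nat list \<Rightarrow> (nat \<times> nat) set" where
  "ferrers xs = {(i, j). i < length xs \<and> j < xs ! i}"

text \<open>The reflection of a Ferrers diagram is its converse relation. Lemmas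
  \<open>partition_of_conj\<close> and \<open>ferrers_conj\<close> below show that
  the description is proper on partitions.\<close>

definition conj_partition :: "nat list \<Rightarrow> nat list" where
  "conj_partition xs =
     (THE ys. partition_of (sum_list xs) ys \<and> ferrers ys = (ferrers xs)\<inverse>)"

definition ary :: "nat \<Rightarrow> nat list \<Rightarrow> bool" where
  "ary m xs \<longleftrightarrow> (\<forall>p\<in>set xs. \<exists>i. p = m ^ i)"

definition conjugate_ary :: "nat \<Rightarrow> nat \<Rightarrow> nat list \<Rightarrow> bool" where
  "conjugate_ary m q xs \<longleftrightarrow> ary m xs \<and> ary q (conj_partition xs)"

text \<open>\<open>of_mults m [a\<^sub>k, \<dots>, a\<^sub>0]\<close> is the partition
  $(a_k, \ldots, a_0)_m$, and \<open>mults m\<close> reads the tuple off a nonempty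
  \<open>m\<close>-ary partition, starting at the largest part $m^k$, so that
  $a_k \neq 0$; see \<open>of_mults_mults\<close> and \<open>mults_of_mults\<close>.\<close>

primrec of_mults :: "nat \<Rightarrow> nat list \<Rightarrow> nat list" where
  "of_mults m [] = []"
| "of_mults m (a # as) = replicate a (m ^ length as) @ of_mults m as"

definition mults :: "nat \<Rightarrow> nat list \<Rightarrow> nat list" where
  "mults m xs = map (\<lambda>i. count_list xs (m ^ i)) (rev [0..<Suc (Max {i. m ^ i \<in> set xs})])"

text \<open>The second base is kept as an argument of all four operators for uniformity, although
  migration and shift do not depend on it. On nonempty \<open>m\<close>-ary partitions the
  subtractions do not truncate, as the leading multiplicity is nonzero.\<close>

definition raise_op :: "nat \<Rightarrow> nat \<Rightarrow> nat list \<Rightarrow> nat list" where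
  "raise_op m q xs = of_mults m (map (\<lambda>a. q * a) (mults m xs))"

definition migration_op :: "nat \<Rightarrow> nat \<Rightarrow> nat list \<Rightarrow> nat list" where
  "migration_op m q xs = of_mults m (1 # (hd (mults m xs) - 1) # tl (mults m xs))"

definition shift_op :: "nat \<Rightarrow> nat \<Rightarrow> nat list \<Rightarrow> nat list" where
  "shift_op m q xs = of_mults m (mults m xs @ [0])"

definition jump_op :: "nat \<Rightarrow> nat \<Rightarrow> nat list \<Rightarrow> nat list" where
  "jump_op m q xs =
     (let as = mults m xs; t = (THE t. sum_list as = q ^ t)
      in of_mults m (butlast as @ [last as + (q ^ (t + 1) - q ^ t)]))"

lemma sum_list_eq_card_ferrers: "sum_list xs = card (ferrers xs)"
proof -
  have "ferrers xs = Sigma {..<length xs} (\<lambda>i. {..<xs ! i})"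
    by (auto simp: ferrers_def)
  then show ?thesis
    by (simp add: sum_list_sum_nth atLeast0LessThan)
qed

lemma ferrers_inj:
  assumes xs: "0 \<notin> set xs" and ys: "0 \<notin> set ys" and eq: "ferrers xs = ferrers ys"
  shows "xs = ys"
proof (rule nth_equalityI)
  have len: "i < length zs \<longleftrightarrow> (i, 0) \<in> ferrers zs" if "0 \<notin> set zs" for i zs
    using that by (auto simp: ferrers_def) (metis neq0_conv nth_mem)
  have "i < length xs \<longleftrightarrow> i < length ys" for i
    using len[OF xs] len[OF ys] eq by simp
  then show l: "length xs = length ys"
    by (metis linorder_neqE_nat less_irrefl)
  show "xs ! i = ys ! i" if "i < length xs" for i
  proof -
    have "j < xs ! i \<longleftrightarrow> j < ys ! i" for j
      using eq that l by (auto simp: ferrers_def set_eq_iff)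
    then show ?thesis
      by (metis linorder_neqE_nat less_irrefl)
  qed
qed

lemma down_closed_eq_lessThan:
  fixes S :: "nat set"
  assumes "finite S" and "\<And>x y. x \<in> S \<Longrightarrow> y \<le> x \<Longrightarrow> y \<in> S"
  shows "S = {..<card S}"
proof (cases "S = {}")
  case False
  then have "S = {..Max S}"
    using assms(1) assms(2)[OF Max_in[OF assms(1)]] by (auto intro: Max_ge)
  then show ?thesis
    by (metis card_atMost lessThan_Suc_atMost)
qed simp

lemma conj_exists:
  assumes "partition_of n xs"
  shows "\<exists>ys. partition_of n ys \<and> ferrers ys = (ferrers xs)\<inverse>"
proof -
  let ?S = "\<lambda>j. {i. i < length xs \<and> j < xs ! i}"
  define h where "h = (if xs = [] then 0 else xs ! 0)"
  define ys where "ys = map (\<lambda>j. card (?S j)) [0..<h]"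
  have mono: "xs ! i \<le> xs ! i'" if "i' \<le> i" "i < length xs" for i i'
  proof (cases "i' = i")
    case False
    then show ?thesis
      using assms that by (auto simp: partition_of_def sorted_wrt_iff_nth_less)
  qed simp
  have S: "?S j = {..<card (?S j)}" for j
    by (rule down_closed_eq_lessThan) (auto intro: less_le_trans[OF _ mono])
  have len: "j < h" if "i < length xs" "j < xs ! i" for i j
    using that mono[of 0 i] by (auto simp: h_def)
  have fy: "ferrers ys = (ferrers xs)\<inverse>"
  proof -
    have "(j, i) \<in> ferrers ys \<longleftrightarrow> (i, j) \<in> ferrers xs" for i j
    proof -
      have "(j, i) \<in> ferrers ys \<longleftrightarrow> j < h \<and> i \<in> {..<card (?S j)}"
        by (auto simp: ferrers_def ys_def)
      also have "\<dots> \<longleftrightarrow> j < h \<and> i \<in> ?S j"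
        using S[of j] by simp
      also have "\<dots> \<longleftrightarrow> (i, j) \<in> ferrers xs"
        using len by (auto simp: ferrers_def)
      finally show ?thesis .
    qed
    then show ?thesis
      by auto
  qed
  have pos: "card (?S j) \<noteq> 0" if "j < h" for j
    using that by (auto simp: h_def split: if_splits intro!: exI[of _ 0])
  have z: "0 \<notin> set ys"
  proof
    assume "0 \<in> set ys"
    then obtain j where "j < h" "card (?S j) = 0"
      unfolding ys_def set_map set_upt by (metis (no_types, lifting) atLeastLessThan_iff imageE)
    then show False
      using pos by blast
  qed
  have "card (?S j') \<le> card (?S j)" if "j \<le> j'" for j j'
    by (rule card_mono) (use that in auto)
  then have srt: "sorted_wrt (\<ge>) ys"
    by (auto simp: ys_def sorted_wrt_iff_nth_less)
  have "sum_list ys = n"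
    using assms by (simp add: sum_list_eq_card_ferrers fy partition_of_def)
  then show ?thesis
    using fy z srt by (auto simp: partition_of_def)
qed

lemma conj_partition_spec:
  assumes "partition_of n xs"
  shows "partition_of n (conj_partition xs) \<and> ferrers (conj_partition xs) = (ferrers xs)\<inverse>"
proof -
  have n: "sum_list xs = n"
    using assms by (simp add: partition_of_def)
  have "\<exists>!ys. partition_of n ys \<and> ferrers ys = (ferrers xs)\<inverse>"
    using conj_exists[OF assms] ferrers_inj by (metis partition_of_def)
  from theI'[OF this] show ?thesis
    by (simp add: conj_partition_def n)
qed

lemmas partition_of_conj = conj_partition_spec[THEN conjunct1]
  and ferrers_conj = conj_partition_spec[THEN conjunct2]

lemma conj_conj:
  assumes "partition_of n xs"
  shows "conj_partition (conj_partition xs) = xs"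
  using assms partition_of_conj[OF partition_of_conj[OF assms]]
    ferrers_conj[OF assms] ferrers_conj[OF partition_of_conj[OF assms]]
  by (intro ferrers_inj) (auto simp: partition_of_def)

lemma count_of_mults:
  assumes "2 \<le> m"
  shows "count_list (of_mults m as) (m ^ i) = (if i < length as then rev as ! i else 0)"
proof (induction as)
  case (Cons a as)
  have c: "count_list (replicate a x) y = (if x = y then a else 0)" for x y :: nat
    by (induction a) auto
  have "m ^ length as = m ^ i \<longleftrightarrow> length as = i"
    using assms by (simp add: power_inject_exp)
  then show ?case
    using Cons by (auto simp: c nth_append)
qed simp

lemma set_of_mults: "x \<in> set (of_mults m as) \<Longrightarrow> \<exists>i < length as. x = m ^ i"
  by (induction as) (auto split: if_splits intro: less_SucI)

lemma ary_of_mults: "ary m (of_mults m as)"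
  using set_of_mults by (fastforce simp: ary_def)

lemma partition_of_mults:
  assumes "2 \<le> m"
  shows "partition_of (sum_list (of_mults m as)) (of_mults m as)"
proof -
  have "sorted_wrt (\<ge>) (of_mults m as)"
  proof (induction as)
    case (Cons a as)
    have r: "sorted_wrt (\<ge>) (replicate a x)" for x :: nat
      by (induction a) auto
    have "y \<le> m ^ length as" if "y \<in> set (of_mults m as)" for y
      using set_of_mults[OF that] assms by (auto intro!: power_increasing)
    then show ?case
      using Cons r by (auto simp: sorted_wrt_append)
  qed simp
  then show ?thesis
    using set_of_mults[of 0 m as] assms by (auto simp: partition_of_def)
qed

lemma mults_of_mults:
  assumes m: "2 \<le> m" and as: "as \<noteq> []" "hd as \<noteq> 0"
  shows "mults m (of_mults m as) = as"
proof -
  obtain a as' where a: "as = a # as'" "a \<noteq> 0"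
    using as by (cases as) auto
  have "{i. m ^ i \<in> set (of_mults m as)} \<subseteq> {..length as'}"
    using set_of_mults[of _ m as] m by (force simp: a power_inject_exp)
  moreover have "m ^ length as' \<in> set (of_mults m as)"
    using a by simp
  ultimately have "Max {i. m ^ i \<in> set (of_mults m as)} = length as'"
    by (intro Max_eqI) (auto intro: finite_subset)
  then have "mults m (of_mults m as)
      = map (\<lambda>i. rev as ! i) (rev [0..<length as])"
    using m by (simp add: mults_def count_of_mults a del: upt_Suc of_mults.simps)
  also have "\<dots> = rev (map (\<lambda>i. rev as ! i) [0..<length (rev as)])"
    by (simp add: rev_map)
  also have "\<dots> = as"
    by (simp only: map_nth rev_rev_ident)
  finally show ?thesis .
qed

lemma sorted_ge_eqI:
  fixes xs ys :: "nat list"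
  assumes "sorted_wrt (\<ge>) xs" "sorted_wrt (\<ge>) ys" "\<And>x. count_list xs x = count_list ys x"
  shows "xs = ys"
proof -
  have "mset xs = mset ys"
    using assms(3) by (auto intro: multiset_eqI simp: count_mset)
  moreover have "sorted (rev xs)" "sorted (rev ys)"
    using assms(1,2) by (simp_all add: sorted_wrt_rev)
  ultimately show ?thesis
    by (metis mset_rev properties_for_sort rev_rev_ident)
qed

lemma of_mults_mults:
  assumes m: "2 \<le> m" and n: "0 < n" and p: "partition_of n xs" and a: "ary m xs"
  shows "of_mults m (mults m xs) = xs" "mults m xs \<noteq> []" "hd (mults m xs) \<noteq> 0"
proof -
  let ?I = "{i. m ^ i \<in> set xs}"
  have "inj_on (\<lambda>i. m ^ i) ?I"
    using m by (simp add: inj_on_def power_inject_exp)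
  then have fin: "finite ?I"
    by (rule inj_on_finite[where B = "set xs"]) auto
  have "xs \<noteq> []"
    using n p by (auto simp: partition_of_def)
  then obtain x where "x \<in> set xs"
    by (meson last_in_set)
  then have "?I \<noteq> {}"
    using a by (auto simp: ary_def)
  then have "Max ?I \<in> ?I"
    using fin Max_in by blast
  then show "mults m xs \<noteq> []" "hd (mults m xs) \<noteq> 0"
    by (auto simp: mults_def hd_map count_list_0_iff)
  have "count_list (of_mults m (mults m xs)) x = count_list xs x" for x
  proof (cases "\<exists>i. x = m ^ i")
    case True
    then obtain i where i: "x = m ^ i" ..
    have "count_list xs (m ^ i) = 0" if "\<not> i < Suc (Max ?I)"
      using that Max_ge[OF fin, of i] by (auto simp: count_list_0_iff)
    moreover have "rev (mults m xs) = map (\<lambda>i. count_list xs (m ^ i)) [0..<Suc (Max ?I)]"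
      by (simp add: mults_def rev_map del: upt_Suc)
    moreover from this have "length (mults m xs) = Suc (Max ?I)"
      by (metis diff_zero length_map length_rev length_upt)
    ultimately show ?thesis
      using m by (auto simp: i count_of_mults simp del: upt_Suc)
  next
    case False
    then have "x \<notin> set xs" "x \<notin> set (of_mults m (mults m xs))"
      using a set_of_mults[of x m "mults m xs"] by (auto simp: ary_def)
    then show ?thesis
      by (simp add: count_list_0_iff[THEN iffD2])
  qed
  then show "of_mults m (mults m xs) = xs"
    using p partition_of_mults[OF m, of "mults m xs"]
    by (intro sorted_ge_eqI) (auto simp: partition_of_def)
qed

lemma operators_of_mults:
  assumes m: "2 \<le> m" and as: "as \<noteq> []" "hd as \<noteq> 0"
  shows "raise_op m q (of_mults m as) = of_mults m (map (\<lambda>a. q * a) as)"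
    and "migration_op m q (of_mults m as) = of_mults m (1 # (hd as - 1) # tl as)"
    and "shift_op m q (of_mults m as) = of_mults m (as @ [0])"
    and "2 \<le> q \<Longrightarrow> sum_list as = q ^ t \<Longrightarrow> jump_op m q (of_mults m as)
           = of_mults m (butlast as @ [last as + (q ^ (t + 1) - q ^ t)])"
  using assms
  by (simp_all add: raise_op_def migration_op_def shift_op_def jump_op_def mults_of_mults
      power_inject_exp)

end

theory Submission
  imports Defs
begin

text \<open>In terms of Ferrers diagrams the four operators no longer mention multiplicities. Raise
  replaces every part by \<open>q\<close> copies of itself and shift multiplies every part by \<open>m\<close>, so they
  stretch the diagram vertically and horizontally, respectively. Migration multiplies only the
  largest part by \<open>m\<close>; jump only appends parts \<open>1\<close> until there are \<open>q\<close> times as many parts as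
  before. So they stretch only the first row and only the first column, respectively.
  Reflection in the main diagonal exchanges rows and columns, and hence the two operators of
  each pair. The factors agree because the operators on the conjugate use the bases in exchanged
  roles, and the first column of the conjugate is the first row of the partition.

  That the conjugate is \<open>q\<close>-ary enters in two ways: it gives meaning to the operators on the
  conjugate, and it makes the number of parts a power of \<open>q\<close>, which is why the increment
  $q^{t+1} - q^t$ of the jump multiplies the number of parts by \<open>q\<close>.

  One equation of each pair suffices, because the other one is its image under
  conjugation, applied to the conjugate partition.\<close>

lemma length_of_mults: "length (of_mults m as) = sum_list as"
  by (induction as) auto

text \<open>A new last multiplicity moves all other entries of the tuple one power up. This explains
  both the shift (\<open>b = 0\<close>) and the jump, which only enlarges \<open>b\<close>.\<close>

lemma of_mults_snoc: "of_mults m (as @ [b]) = map ((*) m) (of_mults m as) @ replicate b 1"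
  by (induction as) auto

lemma of_mults_map_times:
  "of_mults m (map ((*) q) as) = concat (map (replicate q) (of_mults m as))"
proof (induction as)
  case (Cons a as)
  have "replicate (q * a) x = concat (map (replicate q) (replicate a x))" for x :: nat
    by (induction a) (auto simp: replicate_add)
  with Cons show ?case
    by simp
qed simp

lemma partition_of_ops:
  assumes "2 \<le> m"
  shows "partition_of (sum_list (raise_op m q xs)) (raise_op m q xs)"
    and "partition_of (sum_list (migration_op m q xs)) (migration_op m q xs)"
    and "partition_of (sum_list (shift_op m q xs)) (shift_op m q xs)"
    and "partition_of (sum_list (jump_op m q xs)) (jump_op m q xs)"
  using partition_of_mults[OF assms]
  by (simp_all only: raise_op_def migration_op_def shift_op_def jump_op_def Let_def)

lemma ops_eq:
  assumes m: "2 \<le> m" and n: "0 < n" and p: "partition_of n xs" and a: "ary m xs"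
  shows raise_op_eq: "raise_op m q xs = concat (map (replicate q) xs)"
    and migration_op_eq: "migration_op m q xs = m * hd xs # tl xs"
    and shift_op_eq: "shift_op m q xs = map ((*) m) xs"
    and jump_op_eq: "2 \<le> q \<Longrightarrow> length xs = q ^ t \<Longrightarrow>
          jump_op m q xs = xs @ replicate (q * length xs - length xs) 1"
proof -
  define as where "as = mults m xs"
  have as: "as \<noteq> []" "hd as \<noteq> 0" and xs: "xs = of_mults m as"
    using of_mults_mults[OF assms] by (simp_all add: as_def)
  show "raise_op m q xs = concat (map (replicate q) xs)"
    using of_mults_map_times[of m q as] operators_of_mults(1)[OF m as] by (simp add: xs)
  show "shift_op m q xs = map ((*) m) xs"
    using operators_of_mults(3)[OF m as] by (simp add: xs of_mults_snoc)
  show "migration_op m q xs = m * hd xs # tl xs"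
  proof -
    obtain b bs where "as = Suc b # bs"
      using as by (metis list.collapse not0_implies_Suc)
    then show ?thesis
      using operators_of_mults(2)[OF m as] by (simp add: xs)
  qed
  show "jump_op m q xs = xs @ replicate (q * length xs - length xs) 1"
    if q: "2 \<le> q" and len: "length xs = q ^ t"
  proof -
    have "sum_list as = q ^ t"
      using len by (simp add: xs length_of_mults)
    then have "jump_op m q xs = of_mults m (butlast as @ [last as + (q ^ (t + 1) - q ^ t)])"
      using operators_of_mults(4)[OF m as q] by (simp add: xs)
    also have "\<dots> = of_mults m (butlast as @ [last as]) @ replicate (q ^ (t + 1) - q ^ t) 1"
      by (simp only: of_mults_snoc replicate_add append_assoc)
    finally show ?thesis
      using as by (simp add: xs[symmetric] len)
  qed
qed

lemma ferrers_map_times: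
  assumes "0 < m"
  shows "ferrers (map ((*) m) xs) = {(i, j). (i, j div m) \<in> ferrers xs}"
  using assms by (auto simp: ferrers_def div_less_iff_less_mult mult.commute)

lemma ferrers_concat_replicate:
  assumes q: "0 < q"
  shows "ferrers (concat (map (replicate q) xs)) = {(i, j). (i div q, j) \<in> ferrers xs}"
proof -
  have len: "length (concat (map (replicate q) xs)) = length xs * q" for xs :: "nat list"
    by (induction xs) auto
  have nth: "concat (map (replicate q) xs) ! i = xs ! (i div q)" if "i < length xs * q" for i
    using that
  proof (induction xs arbitrary: i)
    case (Cons x xs)
    show ?case
    proof (cases "i < q")
      case False
      then have "i div q = Suc ((i - q) div q)"
        using q by (simp add: le_div_geq)
      with False Cons show ?thesis
        by (simp add: nth_append)
    qed (simp add: nth_append)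
  qed simp
  show ?thesis
    using q by (auto simp: ferrers_def len nth div_less_iff_less_mult)
qed

lemma ferrers_Cons_times_hd:
  assumes "xs \<noteq> []" and "0 < m"
  shows "ferrers (m * hd xs # tl xs) = ferrers xs \<union> {0} \<times> {..<m * hd xs}"
proof -
  obtain x ys where xs: "xs = x # ys"
    using assms by (cases xs) auto
  have "x \<le> m * x"
    using assms by simp
  then show ?thesis
    by (auto simp: ferrers_def xs nth_Cons split: nat.splits intro: less_le_trans)
qed

text \<open>All parts being positive, the first column already reaches down to row \<open>length xs\<close>, so it
  can be added as a whole.\<close>

lemma ferrers_append_replicate_1:
  assumes "0 \<notin> set xs"
  shows "ferrers (xs @ replicate d 1) = ferrers xs \<union> {..<length xs + d} \<times> {0}"
proof -
  have "0 < xs ! i" if "i < length xs" for i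
    using that assms by (metis neq0_conv nth_mem)
  then show ?thesis
    by (auto simp: ferrers_def nth_append split: if_splits)
qed

lemma conj_partition_eqI:
  assumes "partition_of a xs" "partition_of b ys" "ferrers ys = (ferrers xs)\<inverse>"
  shows "conj_partition xs = ys"
  using assms ferrers_conj[OF assms(1)] partition_of_conj[OF assms(1)]
  by (intro ferrers_inj) (auto simp: partition_of_def)

text \<open>Both sides count the cells of the first row of the diagram.\<close>

lemma length_conj_partition:
  assumes p: "partition_of n xs" and "0 < n"
  shows "length (conj_partition xs) = hd xs"
proof -
  let ?ys = "conj_partition xs"
  have "xs \<noteq> []" and z: "0 \<notin> set ?ys"
    using assms partition_of_conj[OF p] by (auto simp: partition_of_def)
  then have "i < length ?ys \<longleftrightarrow> i < hd xs" for i
  proof -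
    have "i < length ?ys \<longleftrightarrow> (i, 0) \<in> ferrers ?ys"
      using z by (auto simp: ferrers_def) (metis neq0_conv nth_mem)
    also have "\<dots> \<longleftrightarrow> i < hd xs"
      using \<open>xs \<noteq> []\<close> by (simp add: ferrers_conj[OF p]) (simp add: ferrers_def hd_conv_nth)
    finally show ?thesis .
  qed
  then show ?thesis
    by (metis linorder_neqE_nat less_irrefl)
qed

lemma conjugate_ary_conj:
  assumes "partition_of n xs" "conjugate_ary m q xs"
  shows "conjugate_ary q m (conj_partition xs)"
  using assms by (simp add: conjugate_ary_def conj_conj)

lemma conj_raise_op:
  assumes m: "2 \<le> m" and q: "2 \<le> q" and n: "0 < n" and p: "partition_of n xs"
    and a: "conjugate_ary m q xs"
  shows "conj_partition (raise_op m q xs) = shift_op q m (conj_partition xs)"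
proof (rule conj_partition_eqI[OF partition_of_ops(1)[OF m] partition_of_ops(3)[OF q]])
  have ary: "ary m xs" "ary q (conj_partition xs)"
    using a by (auto simp: conjugate_ary_def)
  show "ferrers (shift_op q m (conj_partition xs)) = (ferrers (raise_op m q xs))\<inverse>"
    using q by (auto simp: raise_op_eq[OF m n p ary(1)] ferrers_map_times ferrers_conj[OF p]
        shift_op_eq[OF q n partition_of_conj[OF p] ary(2)] ferrers_concat_replicate)
qed

lemma conj_migration_op:
  assumes m: "2 \<le> m" and q: "2 \<le> q" and n: "0 < n" and p: "partition_of n xs"
    and a: "conjugate_ary m q xs"
  shows "conj_partition (migration_op m q xs) = jump_op q m (conj_partition xs)"
proof (rule conj_partition_eqI[OF partition_of_ops(2)[OF m] partition_of_ops(4)[OF q]])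
  let ?ys = "conj_partition xs"
  have ary: "ary m xs" "ary q ?ys"
    using a by (auto simp: conjugate_ary_def)
  have p': "partition_of n ?ys"
    by (rule partition_of_conj[OF p])
  have xs: "xs \<noteq> []"
    using p n by (auto simp: partition_of_def)
  have len: "length ?ys = hd xs"
    by (rule length_conj_partition[OF p n])
  obtain t where "hd xs = m ^ t"
    using ary(1) hd_in_set[OF xs] by (auto simp: ary_def)
  then have "jump_op q m ?ys = ?ys @ replicate (m * hd xs - hd xs) 1"
    using jump_op_eq[OF q n p' ary(2) m] by (simp add: len)
  moreover have "0 \<notin> set ?ys"
    using p' by (simp add: partition_of_def)
  ultimately have "ferrers (jump_op q m ?ys) = (ferrers xs)\<inverse> \<union> {..<m * hd xs} \<times> {0}"
    using m ferrers_append_replicate_1[of ?ys "m * hd xs - hd xs"]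
    by (simp add: len ferrers_conj[OF p])
  then show "ferrers (jump_op q m ?ys) = (ferrers (migration_op m q xs))\<inverse>"
    using m xs by (auto simp: migration_op_eq[OF m n p ary(1)] ferrers_Cons_times_hd)
qed

theorem lemma2p3:
  fixes m q n :: nat and lam :: "nat list"
  assumes "2 \<le> m" and "2 \<le> q"
    and "0 < n" and "partition_of n lam"
    and "conjugate_ary m q lam"
  shows "(conj_partition (raise_op m q lam) = shift_op q m (conj_partition lam) \<and>
          conj_partition (shift_op m q lam) = raise_op q m (conj_partition lam)) \<and>
         (conj_partition (migration_op m q lam) = jump_op q m (conj_partition lam) \<and>
          conj_partition (jump_op m q lam) = migration_op q m (conj_partition lam))"
proof -
  let ?mu = "conj_partition lam"
  note mu = partition_of_conj[OF assms(4)] conjugate_ary_conj[OF assms(4,5)]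
  have mu': "conj_partition ?mu = lam"
    by (rule conj_conj[OF assms(4)])
  have "conj_partition (shift_op m q lam) = raise_op q m ?mu"
    using conj_raise_op[OF assms(2,1,3) mu] conj_conj[OF partition_of_ops(1)[OF assms(2)]]
    by (metis mu')
  moreover have "conj_partition (jump_op m q lam) = migration_op q m ?mu"
    using conj_migration_op[OF assms(2,1,3) mu] conj_conj[OF partition_of_ops(2)[OF assms(2)]]
    by (metis mu')
  ultimately show ?thesis
    using conj_raise_op[OF assms] conj_migration_op[OF assms] by simp
qed

end
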